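(* Let $C=(C_{ij})_{1\le i,j\le d}$ be a connected Cartan matrix, fix an acyclic orientation of its simple graph, and let $(a(j,n))_{n\in\mathbf N}$, $j=1,\dots,d$, be the sequences of the associated frise. Suppose that the frise is rational, i.e. every sequence $(a(j,n))_{n\in\mathbf N}$ satisfies a linear recurrence. If all the sequences are bounded, then $C$ is of Dynkin type. If they are not all bounded, then $C$ is of Euclidean (affine) type.
   Context: A Cartan matrix is a $d\times d$ integer matrix $C$ with $C_{ii}=2$, $C_{ij}\le 0$ for $i\ne j$, and $C_{ij}\neq0\iff C_{ji}\ne 0$. Its simple graph has vertices $1,\dots,d$ and an undirected edge $\{i,j\}$ whenever $i\ne j$ and $C_{ij}\ne0$; $C$ is connected if this graph is connected. Given an acyclic orientation of this graph (write $i\to j$ if the edge $\{i,j\}$ is oriented from $i$ to $j$), the frise is the family of sequences $a(j,n)$, $j=1,\dots,d$, $n\in\mathbf N$, defined by $a(j,0)=1$ and $$a(j,n)\,a(j,n+1)=1+\Big(\prod_{j\to i}a(i,n)^{|C_{ij}|}\Big)\Big(\prod_{i\to j}a(i,n+1)^{|C_{ij}|}\Big);$$ acyclicity makes this well defined, and the values are positive rationals. A sequence $(a_n)$ of complex numbers satisfies a linear recurrence if there are $k\ge1$ and $\alpha_1,\dots,\alpha_k\in\mathbf C$ with $a_{n+k}=\alpha_1a_{n+k-1}+\dots+\alpha_ka_n$ for all $n$. Dynkin and Euclidean types refer to the standard classification of Cartan matrices (valued diagrams) of finite and affine type. *)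

theory Defs
  imports Complex_Main
begin

text \<open>Matrices are functions nat => nat => int, indices in {1..d}.\<close>

definition cartan_matrix :: "nat \<Rightarrow> (nat \<Rightarrow> nat \<Rightarrow> int) \<Rightarrow> bool" where
  "cartan_matrix d C \<longleftrightarrow>
     (\<forall>i\<in>{1..d}. C i i = 2) \<and>
     (\<forall>i\<in>{1..d}. \<forall>j\<in>{1..d}. i \<noteq> j \<longrightarrow> C i j \<le> 0) \<and>
     (\<forall>i\<in>{1..d}. \<forall>j\<in>{1..d}. C i j \<noteq> 0 \<longleftrightarrow> C j i \<noteq> 0)"

text \<open>Simple graph, as a symmetric relation of ordered pairs.\<close>
definition cartan_edges :: "nat \<Rightarrow> (nat \<Rightarrow> nat \<Rightarrow> int) \<Rightarrow> (nat \<times> nat) set" where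
  "cartan_edges d C = {(i, j). i \<in> {1..d} \<and> j \<in> {1..d} \<and> i \<noteq> j \<and> C i j \<noteq> 0}"

definition cartan_connected :: "nat \<Rightarrow> (nat \<Rightarrow> nat \<Rightarrow> int) \<Rightarrow> bool" where
  "cartan_connected d C \<longleftrightarrow> (\<forall>i\<in>{1..d}. \<forall>j\<in>{1..d}. (i, j) \<in> (cartan_edges d C)\<^sup>*)"

text \<open>An orientation: (i,j) in Ori means i -> j. Every edge gets exactly one direction,
  only edges are oriented, and there is no directed cycle.\<close>
definition acyclic_orientation ::
  "nat \<Rightarrow> (nat \<Rightarrow> nat \<Rightarrow> int) \<Rightarrow> (nat \<times> nat) set \<Rightarrow> bool" where
  "acyclic_orientation d C Ori \<longleftrightarrow>
     Ori \<subseteq> cartan_edges d C \<and>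
     (\<forall>(i, j) \<in> cartan_edges d C. ((i, j) \<in> Ori \<or> (j, i) \<in> Ori) \<and> \<not> ((i, j) \<in> Ori \<and> (j, i) \<in> Ori)) \<and>
     acyclic Ori"

text \<open>The frise: a j n for j in {1..d}, n in N (these relations determine a uniquely).\<close>
definition is_frise ::
  "nat \<Rightarrow> (nat \<Rightarrow> nat \<Rightarrow> int) \<Rightarrow> (nat \<times> nat) set \<Rightarrow> (nat \<Rightarrow> nat \<Rightarrow> real) \<Rightarrow> bool" where
  "is_frise d C Ori a \<longleftrightarrow>
     (\<forall>j\<in>{1..d}. a j 0 = 1) \<and>
     (\<forall>j\<in>{1..d}. \<forall>n. a j n * a j (Suc n) =
        1 + (\<Prod>i\<in>{i\<in>{1..d}. (j, i) \<in> Ori}. a i n ^ nat \<bar>C i j\<bar>) *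
            (\<Prod>i\<in>{i\<in>{1..d}. (i, j) \<in> Ori}. a i (Suc n) ^ nat \<bar>C i j\<bar>))"

definition satisfies_linear_recurrence :: "(nat \<Rightarrow> complex) \<Rightarrow> bool" where
  "satisfies_linear_recurrence s \<longleftrightarrow>
     (\<exists>k::nat. k \<ge> 1 \<and> (\<exists>\<alpha>::nat \<Rightarrow> complex.
        \<forall>n. s (n + k) = (\<Sum>l=1..k. \<alpha> l * s (n + k - l))))"

definition cmat_vec :: "nat \<Rightarrow> (nat \<Rightarrow> nat \<Rightarrow> int) \<Rightarrow> (nat \<Rightarrow> real) \<Rightarrow> nat \<Rightarrow> real" where
  "cmat_vec d C u i = (\<Sum>j\<in>{1..d}. of_int (C i j) * u j)"

text \<open>Kac, Infinite dimensional Lie algebras, Thm 4.3: finite (Dynkin) and affine (Euclidean) type.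
  Vectors u in R^d are functions on {1..d}; u > 0 means all coordinates positive.\<close>
definition finite_type :: "nat \<Rightarrow> (nat \<Rightarrow> nat \<Rightarrow> int) \<Rightarrow> bool" where
  "finite_type d C \<longleftrightarrow>
     \<comment> \<open>det C \<noteq> 0\<close>
     (\<forall>v. (\<forall>i\<in>{1..d}. cmat_vec d C v i = 0) \<longrightarrow> (\<forall>i\<in>{1..d}. v i = 0)) \<and>
     (\<exists>u. (\<forall>i\<in>{1..d}. u i > 0) \<and> (\<forall>i\<in>{1..d}. cmat_vec d C u i > 0)) \<and>
     (\<forall>u. (\<forall>i\<in>{1..d}. cmat_vec d C u i \<ge> 0) \<longrightarrow>
          (\<forall>i\<in>{1..d}. u i > 0) \<or> (\<forall>i\<in>{1..d}. u i = 0))"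

definition affine_type :: "nat \<Rightarrow> (nat \<Rightarrow> nat \<Rightarrow> int) \<Rightarrow> bool" where
  "affine_type d C \<longleftrightarrow>
     \<comment> \<open>corank C = 1\<close>
     (\<exists>v. (\<exists>i\<in>{1..d}. v i \<noteq> 0) \<and> (\<forall>i\<in>{1..d}. cmat_vec d C v i = 0) \<and>
        (\<forall>w. (\<forall>i\<in>{1..d}. cmat_vec d C w i = 0) \<longrightarrow> (\<exists>c::real. \<forall>i\<in>{1..d}. w i = c * v i))) \<and>
     (\<exists>u. (\<forall>i\<in>{1..d}. u i > 0) \<and> (\<forall>i\<in>{1..d}. cmat_vec d C u i = 0)) \<and>
     (\<forall>u. (\<forall>i\<in>{1..d}. cmat_vec d C u i \<ge> 0) \<longrightarrow> (\<forall>i\<in>{1..d}. cmat_vec d C u i = 0))"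

end

theory Submission
  imports Defs "HOL-Number_Theory.Cong"
begin

text \<open>The matrix \<open>C\<close> has an eigenvector \<open>w > 0\<close>, with eigenvalue \<open>s\<close>; the type is finite for
  \<open>s > 0\<close> and affine for \<open>s = 0\<close>. All \<open>a j n\<close> are positive integers, so their logarithms are
  nonnegative, and pairing the logarithm of the frise relations with \<open>w\<close> gives
  \<open>s W(n) = G(n) + V(n+1) - V(n)\<close>, where \<open>W(n) = \<Sum>j. w j ln (a j n)\<close>, the term \<open>G(n) > 0\<close> is at most a
  constant, and \<open>V(n)\<close> is linear in the \<open>ln (a j n)\<close>. If the frise is bounded, then \<open>G\<close> is bounded
  away from 0 and \<open>V\<close> is bounded, so \<open>s > 0\<close>. If \<open>s \<noteq> 0\<close>, the at most exponential growth of linearly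
  recurrent sequences bounds \<open>W(0) + \<dots> + W(N-1)\<close> by a multiple of \<open>N + 1\<close>. Hence infinitely often a
  window of consecutive values lies in a fixed finite set of integers, two such windows agree, and the
  recurrence makes the sequence eventually periodic, hence bounded.\<close>

section \<open>Perron vectors of Cartan matrices\<close>

text \<open>Bolzano-Weierstrass for vectors given as functions on a finite index set: each new
  coordinate costs one more passage to a monotone subsequence.\<close>

lemma bounded_coordinates_convergent_subseq:
  fixes X :: "nat \<Rightarrow> 'a \<Rightarrow> real"
  assumes "finite I" and "\<And>n i. i \<in> I \<Longrightarrow> \<bar>X n i\<bar> \<le> B"
  shows "\<exists>r x. strict_mono r \<and> (\<forall>i\<in>I. (\<lambda>n. X (r n) i) \<longlonglongrightarrow> x i)"
  using assms
proof (induction I rule: finite_induct)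
  case empty
  then show ?case by (auto intro: exI[of _ id] simp: strict_mono_def)
next
  case (insert j I)
  then obtain r x where r: "strict_mono r" "\<And>i. i \<in> I \<Longrightarrow> (\<lambda>n. X (r n) i) \<longlonglongrightarrow> x i"
    by (meson insertCI)
  obtain q where q: "strict_mono q" "monoseq (\<lambda>n. X (r (q n)) j)"
    using seq_monosub[of "\<lambda>n. X (r n) j"] by auto
  have "Bseq (\<lambda>n. X (r (q n)) j)"
    by (rule BseqI'[of _ B]) (use insert.prems in auto)
  then have "convergent (\<lambda>n. X (r (q n)) j)"
    using q(2) by (simp add: Bseq_monoseq_convergent)
  then obtain y where y: "(\<lambda>n. X (r (q n)) j) \<longlonglongrightarrow> y"
    by (auto simp: convergent_def)
  have "(\<lambda>n. X ((r \<circ> q) n) i) \<longlonglongrightarrow> (x(j := y)) i" if "i \<in> insert j I" for i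
  proof (cases "i = j")
    case False
    then have "i \<in> I" using that by simp
    then show ?thesis
      using LIMSEQ_subseq_LIMSEQ[OF r(2) q(1)] False by (simp add: o_def)
  qed (use y in simp)
  then show ?case
    using strict_mono_o[OF r(1) q(1)] by blast
qed

text \<open>Take \<open>c\<close> as the least ratio of \<open>u i\<close> to \<open>w i\<close>.
  Then \<open>u - c w\<close> is nonnegative with a zero, which is the situation of
  \<open>zero_propagates\<close>.\<close>

lemma exists_touching_multiple:
  fixes u w :: "'a \<Rightarrow> real"
  assumes "finite I" "I \<noteq> {}" "\<And>i. i \<in> I \<Longrightarrow> w i > 0"
  shows "\<exists>c. (\<forall>i\<in>I. c * w i \<le> u i) \<and> (\<exists>i\<in>I. u i = c * w i)"
proof -
  define c where "c = Min ((\<lambda>i. u i / w i) ` I)"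
  have "c \<in> (\<lambda>i. u i / w i) ` I"
    unfolding c_def using assms by (intro Min_in) auto
  then obtain i where i: "i \<in> I" "u i = c * w i"
    using assms(3) by (force simp: field_simps)
  have "c * w i \<le> u i" if "i \<in> I" for i
  proof -
    have "c \<le> u i / w i"
      unfolding c_def using assms that by (intro Min_le) auto
    then show ?thesis using assms(3)[OF that] by (simp add: field_simps)
  qed
  with i show ?thesis by blast
qed

lemma cmat_vec_diff_mult:
  "cmat_vec d C (\<lambda>i. u i - c * w i) i = cmat_vec d C u i - c * cmat_vec d C w i"
  by (simp add: cmat_vec_def sum_distrib_left sum_subtractf algebra_simps)

lemma cmat_vec_uminus: "cmat_vec d C (\<lambda>i. - u i) i = - cmat_vec d C u i"
  by (simp add: cmat_vec_def sum_negf)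

lemma cmat_vec_fun_upd_add:
  assumes "j \<in> {1..d}"
  shows "cmat_vec d C (x(j := x j + e)) i = cmat_vec d C x i + of_int (C i j) * e"
proof -
  have "cmat_vec d C (x(j := x j + e)) i =
      (\<Sum>k\<in>{1..d}. of_int (C i k) * x k + (if k = j then of_int (C i j) * e else 0))"
    unfolding cmat_vec_def by (intro sum.cong) (auto simp: algebra_simps)
  also have "\<dots> = cmat_vec d C x i + of_int (C i j) * e"
    using assms by (simp add: sum.distrib cmat_vec_def)
  finally show ?thesis .
qed

locale connected_cartan =
  fixes d :: nat and C :: "nat \<Rightarrow> nat \<Rightarrow> int"
  assumes cartan: "cartan_matrix d C" and conn: "cartan_connected d C"
begin

lemma offdiag_nonpos: "i \<in> {1..d} \<Longrightarrow> j \<in> {1..d} \<Longrightarrow> i \<noteq> j \<Longrightarrow> C i j \<le> 0"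
  using cartan by (auto simp: cartan_matrix_def)

lemma diag: "i \<in> {1..d} \<Longrightarrow> C i i = 2"
  using cartan by (auto simp: cartan_matrix_def)

text \<open>A minimum principle: at a zero of \<open>x\<close> the diagonal term drops out and
  \<open>cmat_vec d C x i\<close> is a sum of nonpositive terms. Being nonnegative, it has only zero
  terms, so \<open>x\<close> vanishes at all neighbours; connectedness does the rest.\<close>

lemma zero_propagates:
  assumes nonneg: "\<And>i. i \<in> {1..d} \<Longrightarrow> x i \<ge> 0"
    and zero: "i0 \<in> {1..d}" "x i0 = 0"
    and sup: "\<And>i. i \<in> {1..d} \<Longrightarrow> x i = 0 \<Longrightarrow> cmat_vec d C x i \<ge> 0"
    and "i \<in> {1..d}"
  shows "x i = 0"
proof -
  have "(i0, i) \<in> (cartan_edges d C)\<^sup>*"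
    using conn assms by (auto simp: cartan_connected_def)
  then show ?thesis
  proof (induction rule: rtrancl_induct)
    case base
    then show ?case using zero by simp
  next
    case (step i j)
    have ij: "i \<in> {1..d}" "j \<in> {1..d}" "C i j \<noteq> 0"
      using step.hyps by (auto simp: cartan_edges_def)
    have np: "of_int (C i k) * x k \<le> 0" if "k \<in> {1..d}" for k
      using offdiag_nonpos[of i k] nonneg[of k] ij that step.IH
      by (cases "k = i") (auto intro: mult_nonpos_nonneg)
    have "cmat_vec d C x i \<le> 0"
      unfolding cmat_vec_def by (rule sum_nonpos) (use np in auto)
    then have "cmat_vec d C x i = 0"
      using sup[OF ij(1) step.IH] by linarith
    then have "(\<Sum>k\<in>{1..d}. - (of_int (C i k) * x k)) = 0"
      by (simp add: cmat_vec_def sum_negf)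
    then have "of_int (C i j) * x j = 0"
      using ij(2) np by (subst (asm) sum_nonneg_eq_0_iff) auto
    then show ?case using ij by simp
  qed
qed

text \<open>Raising a coordinate at which the inequality is strict keeps it strict there and makes it
  strict at all neighbours.\<close>
lemma strict_subeigenvector:
  assumes "\<And>i. i \<in> {1..d} \<Longrightarrow> cmat_vec d C x i \<le> s * x i"
    and "\<exists>i\<in>{1..d}. cmat_vec d C x i < s * x i"
  shows "\<exists>y. (\<forall>i\<in>{1..d}. x i \<le> y i \<and> cmat_vec d C y i < s * y i)"
  using assms
proof (induction "card {i\<in>{1..d}. cmat_vec d C x i = s * x i}" arbitrary: x rule: less_induct)
  case less
  let ?E = "\<lambda>x. {i\<in>{1..d}. cmat_vec d C x i = s * x i}"
  show ?case
  proof (cases "?E x = {}")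
    case True
    then show ?thesis using less.prems by (intro exI[of _ x]) force
  next
    case False
    then obtain i0 where i0: "i0 \<in> ?E x" by blast
    obtain j0 where j0: "j0 \<in> {1..d}" "cmat_vec d C x j0 < s * x j0"
      using less.prems by blast
    have "(i0, j0) \<in> (cartan_edges d C)\<^sup>*"
      using i0 j0 conn by (auto simp: cartan_connected_def)
    \<comment> \<open>On a path from the tight index \<open>i0\<close> to the strict index
      \<open>j0\<close>, some edge leaves the tight set.\<close>
    moreover have "k \<in> ?E x \<or> (\<exists>(i, j) \<in> cartan_edges d C. i \<in> ?E x \<and> j \<notin> ?E x)"
      if "(i0, k) \<in> (cartan_edges d C)\<^sup>*" for k
      using that by (induction rule: rtrancl_induct) (use i0 in blast)+
    ultimately obtain i j where ij: "(i, j) \<in> cartan_edges d C" "i \<in> ?E x" "j \<notin> ?E x"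
      using j0 by fastforce
    have jd: "i \<in> {1..d}" "j \<in> {1..d}" "i \<noteq> j" "C i j \<noteq> 0"
      using ij by (auto simp: cartan_edges_def)
    have Cij: "C i j < 0" using offdiag_nonpos jd by force
    have gap: "cmat_vec d C x j < s * x j" using less.prems(1)[of j] ij jd by force
    \<comment> \<open>Raising \<open>x j\<close> by \<open>e\<close> uses up
      \<open>(2 - s) * e\<close> of the gap at \<open>j\<close>. This choice stays below the gap for
      either sign of \<open>2 - s\<close>, and the 1 keeps the denominator positive.\<close>
    define e where "e = (s * x j - cmat_vec d C x j) / (\<bar>2 - s\<bar> + 1)"
    have e: "e > 0" unfolding e_def using gap by (intro divide_pos_pos) auto
    have "(2 - s) * e \<le> \<bar>2 - s\<bar> * e" using e by (intro mult_right_mono) auto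
    also have "\<dots> < (\<bar>2 - s\<bar> + 1) * e" using e by (intro mult_strict_right_mono) auto
    also have "\<dots> = s * x j - cmat_vec d C x j" unfolding e_def by simp
    finally have small: "(2 - s) * e < s * x j - cmat_vec d C x j" .
    define y where "y = x(j := x j + e)"
    have y: "cmat_vec d C y k = cmat_vec d C x k + of_int (C k j) * e" for k
      unfolding y_def using jd by (intro cmat_vec_fun_upd_add) auto
    have yj: "cmat_vec d C y j < s * y j"
      unfolding y using small diag[of j] jd by (simp add: y_def algebra_simps)
    have yk: "cmat_vec d C y k \<le> cmat_vec d C x k" "y k = x k" if "k \<in> {1..d}" "k \<noteq> j" for k
      unfolding y using e offdiag_nonpos[of k j] jd that
      by (auto simp: y_def intro: mult_nonpos_nonneg)
    have yi: "cmat_vec d C y i < s * y i"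
      unfolding y using e Cij jd ij by (auto simp: y_def mult_neg_pos)
    have le: "cmat_vec d C y k \<le> s * y k" if "k \<in> {1..d}" for k
      using yj yk[OF that] less.prems(1)[OF that] by (cases "k = j") auto
    have "?E y \<subseteq> ?E x - {i}"
    proof
      fix k assume k: "k \<in> ?E y"
      then have "k \<noteq> j" "k \<noteq> i" using yj yi by auto
      moreover have "k \<in> {1..d}" using k by simp
      ultimately show "k \<in> ?E x - {i}" using k yk[of k] less.prems(1)[of k] by auto
    qed
    then have "card (?E y) < card (?E x)"
      using ij by (intro psubset_card_mono) auto
    from less.hyps[OF this le] yj jd obtain z
      where z: "\<forall>i\<in>{1..d}. y i \<le> z i \<and> cmat_vec d C z i < s * z i" by blast
    have "x k \<le> y k" for k using e by (simp add: y_def)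
    then have "x k \<le> z k" if "k \<in> {1..d}" for k using z that order_trans by blast
    with z show ?thesis by blast
  qed
qed

text \<open>Collatz--Wielandt: the least \<open>s\<close> admitting a nonzero \<open>x \<ge> 0\<close> with \<open>C x \<le> s x\<close> is attained,
  and by minimality equality holds there.\<close>
lemma perron_vector:
  assumes "d \<ge> 1"
  shows "\<exists>s w. (\<forall>i\<in>{1..d}. w i > 0 \<and> cmat_vec d C w i = s * w i)"
proof -
  \<comment> \<open>Fixing the coordinate sum at 1 keeps the vectors bounded and their limits
    nonzero.\<close>
  define S where "S = {s::real. \<exists>x. (\<forall>i\<in>{1..d}. x i \<ge> 0 \<and> cmat_vec d C x i \<le> s * x i) \<and>
    (\<Sum>i\<in>{1..d}. x i) = 1}"
  have normalize: "s \<in> S" if nn: "\<And>i. i \<in> {1..d} \<Longrightarrow> x i \<ge> 0"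
    and sub: "\<And>i. i \<in> {1..d} \<Longrightarrow> cmat_vec d C x i \<le> s * x i"
    and pos: "\<exists>i\<in>{1..d}. x i > 0" for s x
  proof -
    define t where "t = (\<Sum>i\<in>{1..d}. x i)"
    have t: "t > 0" using pos nn by (auto simp: t_def intro: sum_pos2)
    have "cmat_vec d C (\<lambda>i. x i / t) i = cmat_vec d C x i / t" for i
      by (simp add: cmat_vec_def sum_divide_distrib)
    then have "cmat_vec d C (\<lambda>i. x i / t) i \<le> s * (x i / t)" if "i \<in> {1..d}" for i
      using divide_right_mono[OF sub[OF that], of t] t by simp
    moreover have "(\<Sum>i\<in>{1..d}. x i / t) = 1"
      using t by (simp add: sum_divide_distrib[symmetric] t_def)
    ultimately show ?thesis
      unfolding S_def using t nn by (intro CollectI exI[of _ "\<lambda>i. x i / t"]) auto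
  qed
  define K :: real where "K = (\<Sum>i\<in>{1..d}. \<Sum>j\<in>{1..d}. \<bar>of_int (C i j)\<bar>)"
  have row: "(\<Sum>j\<in>{1..d}. \<bar>of_int (C i j)\<bar>) \<le> K" if "i \<in> {1..d}" for i
    unfolding K_def by (rule member_le_sum[OF that]) (auto intro: sum_nonneg)
  have "K \<in> S"
  proof (rule normalize[of "\<lambda>_. 1"])
    fix i assume i: "i \<in> {1..d}"
    have "cmat_vec d C (\<lambda>_. 1) i \<le> (\<Sum>j\<in>{1..d}. \<bar>of_int (C i j)\<bar>)"
      unfolding cmat_vec_def by (rule sum_mono) auto
    then show "cmat_vec d C (\<lambda>_. 1) i \<le> K * 1" using row[OF i] by simp
  qed (use assms in auto)
  \<comment> \<open>Read the inequality at an index where \<open>x\<close> attains its maximum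
    \<open>m\<close>: the left side is at least \<open>- K * m\<close>.\<close>
  have lower: "- K \<le> s" if s: "s \<in> S" for s
  proof -
    obtain x where x: "\<And>i. i \<in> {1..d} \<Longrightarrow> x i \<ge> 0"
      "\<And>i. i \<in> {1..d} \<Longrightarrow> cmat_vec d C x i \<le> s * x i" "(\<Sum>i\<in>{1..d}. x i) = 1"
      using s unfolding S_def by blast
    define m where "m = Max (x ` {1..d})"
    have "m \<in> x ` {1..d}" unfolding m_def using assms by (intro Max_in) auto
    then obtain i where i: "i \<in> {1..d}" "x i = m" by auto
    have le: "x j \<le> m" if "j \<in> {1..d}" for j unfolding m_def using that by (intro Max_ge) auto
    have "m \<noteq> 0"
    proof
      assume "m = 0"
      then have "(\<Sum>i\<in>{1..d}. x i) = 0" using le x(1) by (intro sum.neutral) force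
      then show False using x(3) by simp
    qed
    then have m: "m > 0" using i x(1)[of i] by simp
    have "- (K * m) \<le> - (\<Sum>j\<in>{1..d}. \<bar>of_int (C i j)\<bar> * m)"
      using row[OF i(1)] m by (simp add: sum_distrib_right[symmetric])
    also have "\<dots> = (\<Sum>j\<in>{1..d}. - (\<bar>of_int (C i j)\<bar> * m))" by (simp add: sum_negf)
    also have "\<dots> \<le> (\<Sum>j\<in>{1..d}. of_int (C i j) * x j)"
    proof (rule sum_mono)
      fix j assume j: "j \<in> {1..d}"
      have "\<bar>of_int (C i j) * x j\<bar> \<le> \<bar>of_int (C i j)\<bar> * m"
        using le[OF j] x(1)[OF j] by (auto simp: abs_mult intro: mult_left_mono)
      then show "- (\<bar>of_int (C i j)\<bar> * m) \<le> of_int (C i j) * x j" by linarith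
    qed
    also have "\<dots> \<le> s * m" using x(2)[OF i(1)] i(2) by (simp add: cmat_vec_def)
    finally have "(- K) * m \<le> s * m" by simp
    then show ?thesis using m by (simp only: mult_le_cancel_right_pos)
  qed
  then have bdd: "bdd_below S" by (meson bdd_belowI)
  define s where "s = Inf S"
  have "\<exists>t\<in>S. t < s + 1 / real (Suc n)" for n
    unfolding s_def using \<open>K \<in> S\<close> bdd cInf_less_iff[of S "Inf S + 1 / real (Suc n)"] by auto
  then obtain t where t: "\<And>n. t n \<in> S" "\<And>n. t n < s + 1 / real (Suc n)" by metis
  have ts: "t n \<ge> s" for n unfolding s_def using t(1) bdd by (rule cInf_lower)
  have tlim: "t \<longlonglongrightarrow> s"
  proof (rule tendsto_sandwich[of "\<lambda>_. s" _ _ "\<lambda>n. s + 1 / real (Suc n)"])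
    show "(\<lambda>n. s + 1 / real (Suc n)) \<longlonglongrightarrow> s"
      using tendsto_add[OF tendsto_const LIMSEQ_inverse_real_of_nat, of s]
      by (simp add: inverse_eq_divide)
  qed (use t ts in \<open>auto intro!: always_eventually less_imp_le\<close>)
  have "\<forall>n. \<exists>x. (\<forall>i\<in>{1..d}. x i \<ge> 0 \<and> cmat_vec d C x i \<le> t n * x i) \<and> (\<Sum>i\<in>{1..d}. x i) = 1"
    using t(1) unfolding S_def by blast
  then obtain X where X: "\<And>n i. i \<in> {1..d} \<Longrightarrow> X n i \<ge> 0"
    "\<And>n i. i \<in> {1..d} \<Longrightarrow> cmat_vec d C (X n) i \<le> t n * X n i"
    "\<And>n. (\<Sum>i\<in>{1..d}. X n i) = 1"
    by metis
  have "\<bar>X n i\<bar> \<le> 1" if "i \<in> {1..d}" for n i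
    using member_le_sum[of i "{1..d}" "X n"] that X(1)[of _ n] X(3)[of n] by auto
  then have "\<exists>r x. strict_mono r \<and> (\<forall>i\<in>{1..d}. (\<lambda>n. X (r n) i) \<longlonglongrightarrow> x i)"
    by (rule bounded_coordinates_convergent_subseq[OF finite_atLeastAtMost])
  then obtain r x where r: "strict_mono r" and rx: "\<forall>i\<in>{1..d}. (\<lambda>n. X (r n) i) \<longlonglongrightarrow> x i"
    by (elim exE conjE)
  note x = bspec[OF rx]
  have trlim: "(\<lambda>n. t (r n)) \<longlonglongrightarrow> s"
    using LIMSEQ_subseq_LIMSEQ[OF tlim r] by (simp add: o_def)
  have xnn: "x i \<ge> 0" if "i \<in> {1..d}" for i
    using LIMSEQ_le_const[OF x[OF that], of 0] X(1)[OF that] by auto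
  have xsum: "(\<Sum>i\<in>{1..d}. x i) = 1"
  proof (rule LIMSEQ_unique)
    show "(\<lambda>n. \<Sum>i\<in>{1..d}. X (r n) i) \<longlonglongrightarrow> (\<Sum>i\<in>{1..d}. x i)"
      by (rule tendsto_sum) (use x in auto)
  qed (simp only: X(3) tendsto_const)
  have xsub: "cmat_vec d C x i \<le> s * x i" if "i \<in> {1..d}" for i
  proof (rule LIMSEQ_le)
    show "(\<lambda>n. cmat_vec d C (X (r n)) i) \<longlonglongrightarrow> cmat_vec d C x i"
      unfolding cmat_vec_def by (intro tendsto_sum tendsto_mult tendsto_const x)
    show "(\<lambda>n. t (r n) * X (r n) i) \<longlonglongrightarrow> s * x i"
      by (intro tendsto_mult trlim x that)
  qed (use X(2) that in auto)
  have eq: "cmat_vec d C x i = s * x i" if "i \<in> {1..d}" for i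
  proof (rule ccontr)
    assume "cmat_vec d C x i \<noteq> s * x i"
    then have "cmat_vec d C x i < s * x i" using xsub[OF that] by simp
    then obtain y where "\<forall>i\<in>{1..d}. x i \<le> y i \<and> cmat_vec d C y i < s * y i"
      using strict_subeigenvector[OF xsub] \<open>i \<in> {1..d}\<close> by metis
    then have y: "\<And>i. i \<in> {1..d} \<Longrightarrow> x i \<le> y i"
      "\<And>i. i \<in> {1..d} \<Longrightarrow> cmat_vec d C y i < s * y i"
      by simp_all
    \<comment> \<open>The least \<open>g i\<close> is an amount by which \<open>s\<close> can be
      lowered with \<open>y\<close> still admissible. Only \<open>y i \<ge> 0\<close> is known,
      hence the 1 in the denominator.\<close>
    define g where "g = (\<lambda>i. (s * y i - cmat_vec d C y i) / (y i + 1))"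
    have ynn: "y i \<ge> 0" if "i \<in> {1..d}" for i using xnn[OF that] y(1)[OF that] by linarith
    define e where "e = Min (g ` {1..d})"
    have "e \<in> g ` {1..d}" unfolding e_def using assms by (intro Min_in) auto
    then have e: "e > 0"
      unfolding g_def using y(2) ynn by (auto intro!: divide_pos_pos add_nonneg_pos)
    have "s - e \<in> S"
    proof (rule normalize[OF ynn])
      fix i assume i: "i \<in> {1..d}"
      have "e \<le> g i" unfolding e_def using i by (intro Min_le) auto
      then have "e * (y i + 1) \<le> s * y i - cmat_vec d C y i"
        unfolding g_def using ynn[OF i] by (simp add: field_simps)
      then show "cmat_vec d C y i \<le> (s - e) * y i" using e by (simp add: algebra_simps)
    next
      have "\<exists>i\<in>{1..d}. x i \<noteq> 0" using xsum sum.neutral[of "{1..d}" x] by fastforce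
      then show "\<exists>i\<in>{1..d}. y i > 0" using xnn y(1) by force
    qed
    then have "s \<le> s - e" unfolding s_def using bdd by (intro cInf_lower)
    then show False using e by simp
  qed
  have "x i \<noteq> 0" if "i \<in> {1..d}" for i
  proof
    assume "x i = 0"
    then have "x k = 0" if "k \<in> {1..d}" for k
      using zero_propagates[of x i k] xnn eq \<open>i \<in> {1..d}\<close> that by simp
    then show False using xsum by simp
  qed
  then show ?thesis using xnn eq by (intro exI[of _ s] exI[of _ x]) (force simp: less_le)
qed

section \<open>Reading off the type from the sign of the eigenvalue\<close>

text \<open>Let \<open>c w\<close> touch \<open>u\<close> from below. If \<open>c > 0\<close>, then
  \<open>u > 0\<close>. Otherwise \<open>C (u - c w) \<ge> 0\<close>, so \<open>u = c w\<close> by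
  the minimum principle, and \<open>C u = c s w \<ge> 0\<close> forces \<open>c = 0\<close>. This
  dichotomy for \<open>v\<close> and \<open>- v\<close> gives the trivial kernel.\<close>

lemma finite_type_of_perron:
  assumes w: "\<And>i. i \<in> {1..d} \<Longrightarrow> w i > 0 \<and> cmat_vec d C w i = s * w i" and "s > 0"
  shows "finite_type d C"
proof -
  have dich: "(\<forall>i\<in>{1..d}. u i > 0) \<or> (\<forall>i\<in>{1..d}. u i = 0)"
    if u: "\<forall>i\<in>{1..d}. cmat_vec d C u i \<ge> 0" for u
  proof (cases "{1..d} = {}")
    case False
    then obtain c i0 where c: "\<forall>i\<in>{1..d}. c * w i \<le> u i" and i0: "i0 \<in> {1..d}" "u i0 = c * w i0"
      using exists_touching_multiple[of "{1..d}" w u] w by auto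
    show ?thesis
    proof (cases "c > 0")
      case True
      then have "u i > 0" if "i \<in> {1..d}" for i
        using c[rule_format, OF that] w[OF that] mult_pos_pos[OF True, of "w i"] by linarith
      then show ?thesis by blast
    next
      case False
      have "u i - c * w i = 0" if "i \<in> {1..d}" for i
      proof (rule zero_propagates[of "\<lambda>i. u i - c * w i" i0])
        fix k assume k: "k \<in> {1..d}"
        have "c * (s * w k) \<le> 0" using False w[OF k] \<open>s > 0\<close> by (simp add: mult_nonpos_nonneg)
        then show "cmat_vec d C (\<lambda>i. u i - c * w i) k \<ge> 0"
          using u[rule_format, OF k] w[OF k] by (simp add: cmat_vec_diff_mult)
      qed (use c i0 that in auto)
      then have ueq: "u i = c * w i" if "i \<in> {1..d}" for i using that by force
      have "cmat_vec d C u i0 = c * (s * w i0)"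
        using ueq w[OF i0(1), THEN conjunct2, symmetric]
        by (simp add: cmat_vec_def sum_distrib_left mult.left_commute)
      then have "c * (s * w i0) \<ge> 0" using u i0 by force
      then have "c = 0" using False w[OF i0(1)] mult_pos_pos[OF \<open>s > 0\<close>, of "w i0"]
        by (auto simp: zero_le_mult_iff)
      then show ?thesis using ueq by simp
    qed
  qed simp
  moreover have "v i = 0" if v: "\<forall>i\<in>{1..d}. cmat_vec d C v i = 0" and i: "i \<in> {1..d}" for v i
    using dich[of v] dich[of "\<lambda>i. - v i"] v i by (force simp: cmat_vec_uminus)
  moreover have "\<exists>u. (\<forall>i\<in>{1..d}. u i > 0) \<and> (\<forall>i\<in>{1..d}. cmat_vec d C u i > 0)"
    using w \<open>s > 0\<close> by (intro exI[of _ w]) auto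
  ultimately show ?thesis unfolding finite_type_def by blast
qed

text \<open>With eigenvalue 0, subtracting \<open>c w\<close> does not change \<open>C u\<close>.
  Hence every \<open>u\<close> with \<open>C u \<ge> 0\<close> equals the multiple of
  \<open>w\<close> that touches it, which gives both corank 1 and \<open>C u = 0\<close>.\<close>

lemma affine_type_of_perron:
  assumes w: "\<And>i. i \<in> {1..d} \<Longrightarrow> w i > 0 \<and> cmat_vec d C w i = 0" and "d \<ge> 1"
  shows "affine_type d C"
proof -
  have mult: "\<exists>c. \<forall>i\<in>{1..d}. u i = c * w i"
    if u: "\<forall>i\<in>{1..d}. cmat_vec d C u i \<ge> 0" for u
  proof -
    obtain c i0 where c: "\<forall>i\<in>{1..d}. c * w i \<le> u i" and i0: "i0 \<in> {1..d}" "u i0 = c * w i0"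
      using exists_touching_multiple[of "{1..d}" w u] w \<open>d \<ge> 1\<close> by auto
    have "u i - c * w i = 0" if "i \<in> {1..d}" for i
      by (rule zero_propagates[of "\<lambda>i. u i - c * w i" i0])
        (use c i0 that u w in \<open>auto simp: cmat_vec_diff_mult\<close>)
    then show ?thesis by (intro exI[of _ c]) force
  qed
  have "cmat_vec d C u i = 0"
    if u: "\<forall>i\<in>{1..d}. cmat_vec d C u i \<ge> 0" and i: "i \<in> {1..d}" for u i
  proof -
    obtain c where "\<forall>i\<in>{1..d}. u i = c * w i" using mult[OF u] by blast
    then have "cmat_vec d C u i = c * cmat_vec d C w i"
      by (simp add: cmat_vec_def sum_distrib_left mult.left_commute)
    then show ?thesis using w[OF i] by simp
  qed
  moreover have "\<exists>v. (\<exists>i\<in>{1..d}. v i \<noteq> 0) \<and> (\<forall>i\<in>{1..d}. cmat_vec d C v i = 0) \<and>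
      (\<forall>u. (\<forall>i\<in>{1..d}. cmat_vec d C u i = 0) \<longrightarrow> (\<exists>c. \<forall>i\<in>{1..d}. u i = c * v i))"
  proof (intro exI[of _ w] conjI allI impI mult)
    show "\<exists>i\<in>{1..d}. w i \<noteq> 0" using w[of 1] \<open>d \<ge> 1\<close> by (intro bexI[of _ 1]) auto
  qed (use w in auto)
  moreover have "\<exists>u. (\<forall>i\<in>{1..d}. u i > 0) \<and> (\<forall>i\<in>{1..d}. cmat_vec d C u i = 0)"
    using w by blast
  ultimately show ?thesis unfolding affine_type_def by (intro conjI allI impI ballI)
qed

end

section \<open>Integer sequences with a linear recurrence\<close>

text \<open>\<open>R\<close> dominates the initial values as well as the sum of the coefficient
  moduli, so one step of the recurrence gains at most a factor \<open>R\<close>.\<close>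

lemma linear_recurrence_exponential_bound:
  assumes "satisfies_linear_recurrence s"
  shows "\<exists>R\<ge>1. \<forall>n. norm (s n) \<le> R ^ Suc n"
proof -
  obtain k \<alpha> where k: "k \<ge> 1" and rec: "\<And>n. s (n + k) = (\<Sum>l=1..k. \<alpha> l * s (n + k - l))"
    using assms unfolding satisfies_linear_recurrence_def by blast
  define A where "A = (\<Sum>l=1..k. norm (\<alpha> l))"
  define R where "R = 1 + A + (\<Sum>i<k. norm (s i))"
  have A: "A \<ge> 0" unfolding A_def by (simp add: sum_nonneg)
  have Z: "(\<Sum>i<k. norm (s i)) \<ge> 0" by (simp add: sum_nonneg)
  have R: "R \<ge> 1" "A \<le> R" unfolding R_def using A Z by auto
  have "norm (s n) \<le> R ^ Suc n" for n
  proof (induction n rule: less_induct)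
    case (less n)
    show ?case
    proof (cases "n < k")
      case True
      then have "norm (s n) \<le> (\<Sum>i<k. norm (s i))" by (intro member_le_sum) auto
      also have "\<dots> \<le> R" unfolding R_def using A by simp
      also have "\<dots> \<le> R ^ Suc n" using R(1) power_increasing[of 1 "Suc n" R] by simp
      finally show ?thesis .
    next
      case False
      then have "s n = (\<Sum>l=1..k. \<alpha> l * s (n - l))" using rec[of "n - k"] by simp
      also have "norm \<dots> \<le> (\<Sum>l=1..k. norm (\<alpha> l) * R ^ n)"
      proof (rule sum_norm_le)
        fix l assume l: "l \<in> {1..k}"
        have "norm (s (n - l)) \<le> R ^ Suc (n - l)" using l False by (intro less.IH) auto
        also have "\<dots> \<le> R ^ n" using l False R(1) by (intro power_increasing) auto
        finally show "norm (\<alpha> l * s (n - l)) \<le> norm (\<alpha> l) * R ^ n"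
          by (simp add: norm_mult mult_left_mono)
      qed
      also have "\<dots> = A * R ^ n" by (simp add: A_def sum_distrib_right)
      also have "\<dots> \<le> R ^ Suc n" using R by (simp add: mult_right_mono)
      finally show ?thesis .
    qed
  qed
  with R(1) show ?thesis by blast
qed

text \<open>The bound on the logarithmic averages yields infinitely many disjoint windows of length the
  order of the recurrence whose entries are bounded integers. Two of these windows coincide, so the
  sequence is eventually periodic.\<close>
lemma bounded_of_log_averages:
  fixes a :: "nat \<Rightarrow> real"
  assumes rec: "satisfies_linear_recurrence (\<lambda>n. complex_of_real (a n))"
    and int: "\<And>n. a n \<in> \<int>" and ge1: "\<And>n. a n \<ge> 1"
    and avg: "\<And>N. (\<Sum>n<N. ln (a n)) \<le> K * (real N + 1)"
  shows "\<exists>B. \<forall>n. \<bar>a n\<bar> \<le> B"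
proof -
  obtain k \<alpha> where k: "k \<ge> 1"
    and rec: "\<And>n. complex_of_real (a (n + k)) = (\<Sum>l=1..k. \<alpha> l * complex_of_real (a (n + k - l)))"
    using rec unfolding satisfies_linear_recurrence_def by blast
  have lnn: "ln (a n) \<ge> 0" for n using ge1 by simp
  define f where "f m = (\<Sum>n\<in>{m * k..<m * k + k}. ln (a n))" for m
  have fnn: "f m \<ge> 0" for m unfolding f_def by (intro sum_nonneg lnn)
  have fsum: "(\<Sum>m<M. f m) \<le> K * (real M * real k + 1)" for M
    unfolding f_def sum.nat_group using avg[of "M * k"] by simp
  \<comment> \<open>If almost all windows had \<open>f m > T\<close>, the extra 1 per window would
    make the sum of \<open>f\<close> outgrow the bound \<open>fsum\<close>.\<close>
  define T where "T = K * real k + 1"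
  define Z where "Z = {m. f m \<le> T}"
  have "infinite Z"
  proof
    assume "finite Z"
    then obtain m0 where m0: "\<And>m. m \<in> Z \<Longrightarrow> m < m0"
      by (metis finite_nat_set_iff_bounded)
    have "real M \<le> real m0 * T + K" if "M \<ge> m0" for M
    proof -
      have "(real M - real m0) * T = (\<Sum>m\<in>{m0..<M}. T)" using that by (simp add: of_nat_diff)
      also have "\<dots> \<le> (\<Sum>m\<in>{m0..<M}. f m)"
        proof (rule sum_mono)
        fix m assume "m \<in> {m0..<M}"
        then have "m \<notin> Z" using m0[of m] by auto
        then show "T \<le> f m" by (simp add: Z_def)
      qed
      also have "\<dots> \<le> (\<Sum>m<M. f m)" by (rule sum_mono2) (use fnn in auto)
      also have "\<dots> \<le> K * (real M * real k + 1)" by (rule fsum)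
      finally show ?thesis by (simp add: T_def algebra_simps)
    qed
    moreover obtain M :: nat where "real M > max (real m0) (real m0 * T + K)"
      using reals_Archimedean2 by blast
    ultimately show False
      by (metis less_imp_le linorder_not_le max_less_iff_conj of_nat_less_iff)
  qed
  define st where "st m = map (\<lambda>i. \<lfloor>a (m * k + i)\<rfloor>) [0..<k]" for m
  have "st ` Z \<subseteq> {xs. set xs \<subseteq> {0..\<lfloor>exp T\<rfloor>} \<and> length xs = k}"
  proof
    fix xs assume "xs \<in> st ` Z"
    then obtain m where m: "m \<in> Z" "xs = st m" by blast
    \<comment> \<open>All logarithms are nonnegative, so each is at most the sum over its
      window.\<close>
    have "a (m * k + i) \<le> exp T" if "i < k" for i
    proof -
      have "ln (a (m * k + i)) \<le> f m"
        unfolding f_def using that by (intro member_le_sum) (auto simp: lnn)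
      also have "\<dots> \<le> T" using m by (simp add: Z_def)
      finally show ?thesis
        using ge1[of "m * k + i"] by (metis exp_le_cancel_iff exp_ln zero_less_one less_le_trans)
    qed
    moreover have "0 \<le> \<lfloor>a n\<rfloor>" for n using ge1[of n] by simp
    ultimately show "xs \<in> {xs. set xs \<subseteq> {0..\<lfloor>exp T\<rfloor>} \<and> length xs = k}"
      using m by (auto simp: st_def intro!: floor_mono)
  qed
  then have "finite (st ` Z)"
    by (rule finite_subset) (auto intro: finite_lists_length_eq)
  then have "\<not> inj_on st Z" using \<open>infinite Z\<close> finite_imageD by blast
  then obtain m m' where mm: "m < m'" "st m = st m'"
    unfolding inj_on_def by (metis nat_neq_iff)
  define p q where "p = m * k" and "q = m' * k"
  have pq: "p < q" using mm k by (simp add: p_def q_def)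
  have floor: "of_int \<lfloor>a n\<rfloor> = a n" for n using int[of n] by (auto elim: Ints_cases)
  have start: "a (p + i) = a (q + i)" if "i < k" for i
  proof -
    have "st m ! i = st m' ! i" using mm by simp
    then have "\<lfloor>a (p + i)\<rfloor> = \<lfloor>a (q + i)\<rfloor>" using that by (simp add: st_def p_def q_def)
    then show ?thesis by (metis floor)
  qed
  have per: "a (p + i) = a (q + i)" for i
  proof (induction i rule: less_induct)
    case (less i)
    show ?case
    proof (cases "i < k")
      case False
      have "complex_of_real (a (p + i)) = (\<Sum>l=1..k. \<alpha> l * complex_of_real (a (p + i - l)))"
        using rec[of "p + i - k"] False by simp
      also have "\<dots> = (\<Sum>l=1..k. \<alpha> l * complex_of_real (a (q + i - l)))"
      proof (rule sum.cong)
        fix l assume l: "l \<in> {1..k}"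
        then have "a (p + (i - l)) = a (q + (i - l))" using False by (intro less.IH) auto
        then show "\<alpha> l * complex_of_real (a (p + i - l)) = \<alpha> l * complex_of_real (a (q + i - l))"
          using l False by simp
      qed simp
      also have "\<dots> = complex_of_real (a (q + i))"
        using rec[of "q + i - k"] False by simp
      finally show ?thesis by simp
    qed (use start in simp)
  qed
  \<comment> \<open>From \<open>q\<close> on, each value repeats the one \<open>q - p\<close> places
    earlier, and so one with index below \<open>q\<close>.\<close>
  have "a n \<le> Max (a ` {..<q})" for n
  proof (induction n rule: less_induct)
    case (less n)
    show ?case
    proof (cases "n < q")
      case False
      then have "a n = a (p + (n - q))" using per[of "n - q"] by simp
      also have "\<dots> \<le> Max (a ` {..<q})" using False pq by (intro less.IH) auto
      finally show ?thesis .
    qed auto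
  qed
  then have "\<bar>a n\<bar> \<le> Max (a ` {..<q})" for n
    using ge1[of n] by simp
  then show ?thesis by blast
qed

section \<open>Integrality of the frise\<close>

locale cartan_frise = connected_cartan +
  fixes Ori :: "(nat \<times> nat) set" and a :: "nat \<Rightarrow> nat \<Rightarrow> real"
  assumes ori: "acyclic_orientation d C Ori" and frise: "is_frise d C Ori a"
begin

lemma ori_edge: "(i, j) \<in> Ori \<Longrightarrow> i \<in> {1..d} \<and> j \<in> {1..d} \<and> i \<noteq> j \<and> C i j \<noteq> 0 \<and> C j i \<noteq> 0"
  using ori cartan by (auto simp: acyclic_orientation_def cartan_edges_def cartan_matrix_def)

lemma ori_antisym: "(i, j) \<in> Ori \<Longrightarrow> (j, i) \<notin> Ori"
  using ori by (auto simp: acyclic_orientation_def)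

lemma ori_total: "i \<in> {1..d} \<Longrightarrow> j \<in> {1..d} \<Longrightarrow> i \<noteq> j \<Longrightarrow> C i j \<noteq> 0 \<Longrightarrow> (i, j) \<in> Ori \<or> (j, i) \<in> Ori"
  using ori by (auto simp: acyclic_orientation_def cartan_edges_def)

lemma wf_ori: "wf (Ori\<^sup>+)"
proof -
  have "Ori \<subseteq> {1..d} \<times> {1..d}" using ori_edge by auto
  then have "finite Ori" by (rule finite_subset) auto
  then show ?thesis
    using ori by (auto simp: acyclic_orientation_def intro: wf_trancl finite_acyclic_wf)
qed

definition P :: "nat \<Rightarrow> nat \<Rightarrow> real" where
  "P j n = (\<Prod>i\<in>{i\<in>{1..d}. (j, i) \<in> Ori}. a i n ^ nat \<bar>C i j\<bar>) *
            (\<Prod>i\<in>{i\<in>{1..d}. (i, j) \<in> Ori}. a i (Suc n) ^ nat \<bar>C i j\<bar>)"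

lemma a_0: "j \<in> {1..d} \<Longrightarrow> a j 0 = 1"
  using frise by (simp add: is_frise_def)

lemma a_rel: "j \<in> {1..d} \<Longrightarrow> a j n * a j (Suc n) = 1 + P j n"
  using frise by (simp add: is_frise_def P_def)

text \<open>The induction is on \<open>n\<close> first and then along the orientation: \<open>a j (n+1)\<close> depends on \<open>a i (n+1)\<close>
  for \<open>i \<rightarrow> j\<close>. The transitive closure is what the proof of integrality needs.\<close>
lemma frise_induct [consumes 1, case_names 0 Suc]:
  assumes "j \<in> {1..d}"
    and "\<And>j. j \<in> {1..d} \<Longrightarrow> Q j 0"
    and "\<And>n j. j \<in> {1..d} \<Longrightarrow> (\<And>i m. i \<in> {1..d} \<Longrightarrow> m \<le> n \<Longrightarrow> Q i m) \<Longrightarrow>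
      (\<And>i. (i, j) \<in> Ori\<^sup>+ \<Longrightarrow> Q i (Suc n)) \<Longrightarrow> Q j (Suc n)"
  shows "Q j n"
  using assms(1)
proof (induction n arbitrary: j rule: less_induct)
  case (less n)
  note outer = less.IH
  show ?case
  proof (cases n)
    case (Suc m)
    show ?thesis using less.prems
    proof (induction j rule: wf_induct_rule[OF wf_ori])
      case (1 j)
      have mem: "i \<in> {1..d}" if "(i, j) \<in> Ori\<^sup>+" for i
        using that by (metis ori_edge tranclD)
      show ?case unfolding Suc
      proof (rule assms(3)[OF 1(2)])
        fix i l assume "i \<in> {1..d}" "l \<le> m"
        then show "Q i l" using outer Suc by simp
      next
        fix i assume "(i, j) \<in> Ori\<^sup>+"
        then show "Q i (Suc m)" using 1(1)[of i] mem Suc by simp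
      qed
    qed
  qed (use assms(2) less.prems in simp)
qed

lemma a_pos: "j \<in> {1..d} \<Longrightarrow> a j n > 0"
proof (induction j n rule: frise_induct)
  case (0 j)
  then show ?case by (simp add: a_0)
next
  case (Suc n j)
  have "P j n > 0"
    unfolding P_def
    by (intro mult_pos_pos prod_pos ballI zero_less_power) (use Suc in auto)
  then have "a j n * a j (Suc n) > 0" using a_rel[of j n] Suc.hyps by simp
  then show ?case using Suc.IH(1)[of j n] Suc.hyps by (simp add: zero_less_mult_iff)
qed

text \<open>An integer copy of the frise for use in congruences; it agrees with \<open>a\<close>
  exactly at integer values.\<close>

definition b :: "nat \<Rightarrow> nat \<Rightarrow> int" where "b j n = \<lfloor>a j n\<rfloor>"

text \<open>Integrality is assumed only of the entries that occur, because the relation is used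
  inside the induction that proves integrality.\<close>

lemma b_rel:
  assumes "j \<in> {1..d}" "a j n \<in> \<int>" "a j (Suc n) \<in> \<int>"
    and "\<And>i. (j, i) \<in> Ori \<Longrightarrow> a i n \<in> \<int>" "\<And>i. (i, j) \<in> Ori \<Longrightarrow> a i (Suc n) \<in> \<int>"
  shows "b j n * b j (Suc n) = 1 +
    (\<Prod>i\<in>{i\<in>{1..d}. (j, i) \<in> Ori}. b i n ^ nat \<bar>C i j\<bar>) *
    (\<Prod>i\<in>{i\<in>{1..d}. (i, j) \<in> Ori}. b i (Suc n) ^ nat \<bar>C i j\<bar>)"
proof -
  have b: "of_int (b i m) = a i m" if "a i m \<in> \<int>" for i m
    using that by (auto simp: b_def elim: Ints_cases)
  have "real_of_int (b j n * b j (Suc n)) = real_of_int (1 +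
    (\<Prod>i\<in>{i\<in>{1..d}. (j, i) \<in> Ori}. b i n ^ nat \<bar>C i j\<bar>) *
    (\<Prod>i\<in>{i\<in>{1..d}. (i, j) \<in> Ori}. b i (Suc n) ^ nat \<bar>C i j\<bar>))"
    using a_rel[OF assms(1), of n] assms by (simp add: b P_def of_int_prod)
  then show ?thesis by (simp only: of_int_eq_iff)
qed

text \<open>Put \<open>x = a j (n+1)\<close> and let \<open>M\<close>, \<open>M'\<close> be the products in the relations for \<open>a j n * x\<close> and
  \<open>x * a j (n+2)\<close>. Modulo \<open>x\<close> we have \<open>M = -1\<close>, and \<open>M M' = 1\<close> because \<open>x\<close> occurs in the product
  term of the relation at every neighbour of \<open>j\<close>; hence \<open>x\<close> divides \<open>1 + M'\<close>.\<close>
lemma a_int: "j \<in> {1..d} \<Longrightarrow> a j n \<in> \<int>"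
proof (induction j n rule: frise_induct)
  case (0 j)
  then show ?case by (simp add: a_0)
next
  case (Suc n j)
  have Pint: "P j n \<in> \<int>"
    unfolding P_def by (intro Ints_mult Ints_prod Ints_power) (use Suc in auto)
  show ?case
  proof (cases n)
    case 0
    \<comment> \<open>The divisor is \<open>a j 0 = 1\<close> here; later steps rely on the
      preceding relation at \<open>j\<close>.\<close>
    then have "a j (Suc n) = 1 + P j n" using a_rel[of j n] a_0 Suc.hyps by simp
    then show ?thesis using Pint by simp
  next
    case (Suc m)
    note hyp = Suc.IH Suc.hyps
    let ?out = "{i\<in>{1..d}. (j, i) \<in> Ori}" and ?in = "{i\<in>{1..d}. (i, j) \<in> Ori}"
    have ints: "a i k \<in> \<int>" if "i \<in> {1..d}" "k \<le> Suc m" for i k using hyp that Suc by simp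
    have ints': "a i (Suc (Suc m)) \<in> \<int>" if "(i, j) \<in> Ori\<^sup>+" for i using hyp that Suc by simp
    define x where "x = b j (Suc m)"
    define M where "M = (\<Prod>i\<in>?out. b i m ^ nat \<bar>C i j\<bar>) * (\<Prod>i\<in>?in. b i (Suc m) ^ nat \<bar>C i j\<bar>)"
    define M' where "M' = (\<Prod>i\<in>?out. b i (Suc m) ^ nat \<bar>C i j\<bar>) * (\<Prod>i\<in>?in. b i (Suc (Suc m)) ^ nat \<bar>C i j\<bar>)"
    have "b j m * x = 1 + M"
      unfolding x_def M_def by (intro b_rel) (use hyp(3) ints ori_edge in auto)
    then have d1: "x dvd 1 + M" by (metis dvd_triv_right)
    \<comment> \<open>For \<open>i\<close> after \<open>j\<close>, the factor \<open>x\<close>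
      occurs in the relation at \<open>i\<close> between times \<open>m\<close> and
      \<open>m + 1\<close>; for \<open>i\<close> before \<open>j\<close> (fact \<open>inn\<close>),
      in the one between \<open>m + 1\<close> and \<open>m + 2\<close>.\<close>
    have out: "[b i m * b i (Suc m) = 1] (mod x)" if i: "i \<in> ?out" for i
    proof -
      have "b i m * b i (Suc m) = 1 +
        (\<Prod>k\<in>{k\<in>{1..d}. (i, k) \<in> Ori}. b k m ^ nat \<bar>C k i\<bar>) *
        (\<Prod>k\<in>{k\<in>{1..d}. (k, i) \<in> Ori}. b k (Suc m) ^ nat \<bar>C k i\<bar>)"
        by (intro b_rel) (use i ints ori_edge in auto)
      moreover have "x dvd b j (Suc m) ^ nat \<bar>C j i\<bar>"
        unfolding x_def using ori_edge[of j i] i by (intro dvd_power) auto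
      moreover have "\<dots> dvd (\<Prod>k\<in>{k\<in>{1..d}. (k, i) \<in> Ori}. b k (Suc m) ^ nat \<bar>C k i\<bar>)"
        using i hyp(3) by (intro dvd_prodI) auto
      ultimately show ?thesis
        by (simp add: cong_iff_dvd_diff) (rule dvd_mult[OF dvd_trans])
    qed
    have inn: "[b i (Suc m) * b i (Suc (Suc m)) = 1] (mod x)" if i: "i \<in> ?in" for i
    proof -
      have "b i (Suc m) * b i (Suc (Suc m)) = 1 +
        (\<Prod>k\<in>{k\<in>{1..d}. (i, k) \<in> Ori}. b k (Suc m) ^ nat \<bar>C k i\<bar>) *
        (\<Prod>k\<in>{k\<in>{1..d}. (k, i) \<in> Ori}. b k (Suc (Suc m)) ^ nat \<bar>C k i\<bar>)"
      proof (rule b_rel)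
        show "i \<in> {1..d}" "a i (Suc m) \<in> \<int>" using i ints by simp_all
        show "a i (Suc (Suc m)) \<in> \<int>" using i by (intro ints' r_into_trancl) simp
        show "a k (Suc m) \<in> \<int>" if "(i, k) \<in> Ori" for k
          using ori_edge[OF that] ints by simp
        \<comment> \<open>Here \<open>k\<close> precedes \<open>j\<close> through the path
          \<open>k \<rightarrow> i \<rightarrow> j\<close>, possibly without an edge to
          \<open>j\<close>; hence the hypothesis on \<open>Ori\<^sup>+\<close>.\<close>
        have "(i, j) \<in> Ori" using i by simp
        then show "a k (Suc (Suc m)) \<in> \<int>" if "(k, i) \<in> Ori" for k
          by (rule ints'[OF trancl_into_trancl[OF r_into_trancl[OF that]]])
      qed
      moreover have "x dvd b j (Suc m) ^ nat \<bar>C j i\<bar>"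
        unfolding x_def using ori_edge[of i j] i by (intro dvd_power) auto
      moreover have "\<dots> dvd (\<Prod>k\<in>{k\<in>{1..d}. (i, k) \<in> Ori}. b k (Suc m) ^ nat \<bar>C k i\<bar>)"
        using i hyp(3) by (intro dvd_prodI) auto
      ultimately show ?thesis
        by (simp add: cong_iff_dvd_diff) (rule dvd_mult2[OF dvd_trans])
    qed
    have MM: "M * M' = (\<Prod>i\<in>?out. (b i m * b i (Suc m)) ^ nat \<bar>C i j\<bar>) *
        (\<Prod>i\<in>?in. (b i (Suc m) * b i (Suc (Suc m))) ^ nat \<bar>C i j\<bar>)"
      unfolding M_def M'_def by (simp add: prod.distrib power_mult_distrib mult_ac)
    have "[M * M' = (\<Prod>i\<in>?out. 1 ^ nat \<bar>C i j\<bar>) * (\<Prod>i\<in>?in. 1 ^ nat \<bar>C i j\<bar>)] (mod x)"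
      unfolding MM by (intro cong_mult cong_prod cong_pow out inn)
    then have "x dvd M * M' - 1" by (simp add: cong_iff_dvd_diff)
    then have "x dvd (1 + M) * (1 + M') - (1 + M) - (M * M' - 1)"
      by (rule dvd_diff[OF dvd_diff[OF dvd_mult2[OF d1] d1]])
    moreover have "(1 + M) * (1 + M') - (1 + M) - (M * M' - 1) = 1 + M'"
      by (simp add: algebra_simps)
    ultimately obtain y where y: "1 + M' = x * y" by (metis dvdE)
    have b: "of_int (b i k) = a i k" if "a i k \<in> \<int>" for i k
      using that by (auto simp: b_def elim: Ints_cases)
    have "a j (Suc m) * a j (Suc (Suc m)) = of_int (1 + M')"
      unfolding a_rel[OF hyp(3)] P_def M'_def
      by (simp add: b ints ints'[OF r_into_trancl] of_int_prod)
    also have "\<dots> = a j (Suc m) * of_int y"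
      unfolding y x_def using ints hyp(3) by (simp add: b)
    finally have "a j (Suc (Suc m)) = of_int y"
      using a_pos[OF hyp(3), of "Suc m"] by simp
    then show ?thesis using Suc by simp
  qed
qed

lemma a_ge_1: "j \<in> {1..d} \<Longrightarrow> a j n \<ge> 1"
  using a_int[of j n] a_pos[of j n] by (auto elim!: Ints_cases)

section \<open>The logarithmic energy identity\<close>

lemma P_ge_1: "P j n \<ge> 1"
proof -
  have "1 \<le> (\<Prod>i\<in>{i\<in>{1..d}. (j, i) \<in> Ori}. a i n ^ nat \<bar>C i j\<bar>)"
    by (intro prod_ge_1 one_le_power a_ge_1) auto
  moreover have "1 \<le> (\<Prod>i\<in>{i\<in>{1..d}. (i, j) \<in> Ori}. a i (Suc n) ^ nat \<bar>C i j\<bar>)"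
    by (intro prod_ge_1 one_le_power a_ge_1) auto
  ultimately show ?thesis
    unfolding P_def using mult_mono[of 1 _ 1] by fastforce
qed

text \<open>Factoring \<open>1 + P\<close> as \<open>(1 + 1 / P) * P\<close> separates a part linear
  in the logarithms from a positive term, which is at most \<open>ln 2\<close> since
  \<open>P \<ge> 1\<close>.\<close>

lemma ln_a_rel:
  assumes j: "j \<in> {1..d}"
  shows "ln (a j n) + ln (a j (Suc n)) = ln (1 + 1 / P j n) +
    (\<Sum>i\<in>{i\<in>{1..d}. (j, i) \<in> Ori}. of_int \<bar>C i j\<bar> * ln (a i n)) +
    (\<Sum>i\<in>{i\<in>{1..d}. (i, j) \<in> Ori}. of_int \<bar>C i j\<bar> * ln (a i (Suc n)))"
proof -
  have P: "P j n > 0" using P_ge_1[of j n] by linarith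
  have "ln (a j n) + ln (a j (Suc n)) = ln (a j n * a j (Suc n))"
    using a_pos[OF j] by (simp add: ln_mult_pos)
  also have "a j n * a j (Suc n) = (1 + 1 / P j n) * P j n"
    using a_rel[OF j] P by (simp add: field_simps)
  also have "ln \<dots> = ln (1 + 1 / P j n) + ln (P j n)"
    using P by (intro ln_mult_pos) (auto intro: add_pos_nonneg)
  also have "ln (P j n) = ln (\<Prod>i\<in>{i\<in>{1..d}. (j, i) \<in> Ori}. a i n ^ nat \<bar>C i j\<bar>) +
      ln (\<Prod>i\<in>{i\<in>{1..d}. (i, j) \<in> Ori}. a i (Suc n) ^ nat \<bar>C i j\<bar>)"
    unfolding P_def by (intro ln_mult_pos prod_pos zero_less_power) (auto intro: a_pos)
  also have "ln (\<Prod>i\<in>{i\<in>{1..d}. (j, i) \<in> Ori}. a i n ^ nat \<bar>C i j\<bar>) =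
      (\<Sum>i\<in>{i\<in>{1..d}. (j, i) \<in> Ori}. of_int \<bar>C i j\<bar> * ln (a i n))"
    using a_pos by (subst ln_prod) (auto simp: ln_realpow less_imp_neq[symmetric] intro!: sum.cong)
  also have "ln (\<Prod>i\<in>{i\<in>{1..d}. (i, j) \<in> Ori}. a i (Suc n) ^ nat \<bar>C i j\<bar>) =
      (\<Sum>i\<in>{i\<in>{1..d}. (i, j) \<in> Ori}. of_int \<bar>C i j\<bar> * ln (a i (Suc n)))"
    using a_pos by (subst ln_prod) (auto simp: ln_realpow less_imp_neq[symmetric] intro!: sum.cong)
  finally show ?thesis by simp
qed

context
  fixes w :: "nat \<Rightarrow> real" and s :: real
  assumes w_pos: "\<And>i. i \<in> {1..d} \<Longrightarrow> w i > 0"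
    and w_eig: "\<And>i. i \<in> {1..d} \<Longrightarrow> cmat_vec d C w i = s * w i"
begin

definition W :: "nat \<Rightarrow> real" where "W n = (\<Sum>j\<in>{1..d}. w j * ln (a j n))"

definition G :: "nat \<Rightarrow> real" where "G n = (\<Sum>j\<in>{1..d}. w j * ln (1 + 1 / P j n))"

text \<open>Collects what stands at time \<open>n + 1\<close> in \<open>ln_a_rel\<close>, the
  incoming neighbours minus the entry itself, so that moving it to time \<open>n\<close> costs only
  a telescoping difference.\<close>

definition V :: "nat \<Rightarrow> real" where
  "V n = (\<Sum>j\<in>{1..d}. w j * (\<Sum>i\<in>{i\<in>{1..d}. (i, j) \<in> Ori}. of_int \<bar>C i j\<bar> * ln (a i n))) - W n"

text \<open>Every neighbour of \<open>j\<close> lies in exactly one of the two sums, and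
  \<open>\<bar>C i j\<bar> = - C i j\<close> off the diagonal.\<close>

lemma neighbour_sum:
  assumes j: "j \<in> {1..d}"
  shows "(\<Sum>i\<in>{i\<in>{1..d}. (j, i) \<in> Ori}. of_int \<bar>C i j\<bar> * l i) +
    (\<Sum>i\<in>{i\<in>{1..d}. (i, j) \<in> Ori}. of_int \<bar>C i j\<bar> * l i) =
    2 * l j - (\<Sum>i\<in>{1..d}. of_int (C i j) * (l i :: real))"
proof -
  have "(\<Sum>i\<in>{i\<in>{1..d}. (j, i) \<in> Ori}. of_int \<bar>C i j\<bar> * l i) +
    (\<Sum>i\<in>{i\<in>{1..d}. (i, j) \<in> Ori}. of_int \<bar>C i j\<bar> * l i) =
    (\<Sum>i\<in>{1..d}. (if (j, i) \<in> Ori then of_int \<bar>C i j\<bar> * l i else 0) +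
      (if (i, j) \<in> Ori then of_int \<bar>C i j\<bar> * l i else 0))"
    by (simp only: sum.distrib sum.inter_filter[symmetric] finite_atLeastAtMost)
  also have "\<dots> = (\<Sum>i\<in>{1..d}. (if i = j then 2 * l j else 0) - of_int (C i j) * l i)"
  proof (rule sum.cong)
    fix i assume i: "i \<in> {1..d}"
    show "(if (j, i) \<in> Ori then of_int \<bar>C i j\<bar> * l i else 0) +
      (if (i, j) \<in> Ori then of_int \<bar>C i j\<bar> * l i else 0) =
      (if i = j then 2 * l j else 0) - of_int (C i j) * l i"
      using ori_edge[of i j] ori_edge[of j i] ori_antisym[of i j] ori_total[of i j]
        offdiag_nonpos[of i j] diag[of j] i j
      by (cases "i = j"; cases "C i j = 0") (auto simp: abs_if)
  qed simp
  also have "\<dots> = 2 * l j - (\<Sum>i\<in>{1..d}. of_int (C i j) * l i)"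
    using j by (simp add: sum_subtractf)
  finally show ?thesis .
qed

lemma energy_step: "s * W n = G n + (V (Suc n) - V n)"
proof -
  let ?l = "\<lambda>i. ln (a i n)"
  let ?R = "\<lambda>n. \<Sum>j\<in>{1..d}. w j * (\<Sum>i\<in>{i\<in>{1..d}. (i, j) \<in> Ori}. of_int \<bar>C i j\<bar> * ln (a i n))"
  let ?Q = "\<Sum>j\<in>{1..d}. w j * (\<Sum>i\<in>{i\<in>{1..d}. (j, i) \<in> Ori}. of_int \<bar>C i j\<bar> * ln (a i n))"
  have "W n + W (Suc n) = (\<Sum>j\<in>{1..d}. w j * (ln (a j n) + ln (a j (Suc n))))"
    by (simp add: W_def sum.distrib distrib_left)
  also have "\<dots> = (\<Sum>j\<in>{1..d}. w j * (ln (1 + 1 / P j n) +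
    (\<Sum>i\<in>{i\<in>{1..d}. (j, i) \<in> Ori}. of_int \<bar>C i j\<bar> * ln (a i n)) +
    (\<Sum>i\<in>{i\<in>{1..d}. (i, j) \<in> Ori}. of_int \<bar>C i j\<bar> * ln (a i (Suc n)))))"
    by (intro sum.cong refl arg_cong2[where f = "(*)"] ln_a_rel)
  also have "\<dots> = G n + ?Q + ?R (Suc n)"
    by (simp only: G_def sum.distrib distrib_left)
  finally have 1: "W n + W (Suc n) = G n + ?Q + ?R (Suc n)" .
  have "?Q + ?R n = (\<Sum>j\<in>{1..d}. w j * (2 * ?l j - (\<Sum>i\<in>{1..d}. of_int (C i j) * ?l i)))"
    unfolding sum.distrib[symmetric] distrib_left[symmetric]
    by (intro sum.cong refl arg_cong2[where f = "(*)"] neighbour_sum)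
  also have "\<dots> = 2 * W n - (\<Sum>j\<in>{1..d}. \<Sum>i\<in>{1..d}. w j * (of_int (C i j) * ?l i))"
    by (simp add: W_def right_diff_distrib sum_subtractf sum_distrib_left mult.left_commute)
  \<comment> \<open>The columns of \<open>C\<close> act on the logarithms; swapping the sums lets
    the rows act on \<open>w\<close>, where the eigenvector equation applies.\<close>
  also have "(\<Sum>j\<in>{1..d}. \<Sum>i\<in>{1..d}. w j * (of_int (C i j) * ?l i)) =
      (\<Sum>i\<in>{1..d}. \<Sum>j\<in>{1..d}. w j * (of_int (C i j) * ?l i))" by (rule sum.swap)
  also have "\<dots> = (\<Sum>i\<in>{1..d}. cmat_vec d C w i * ?l i)"
    by (simp add: cmat_vec_def sum_distrib_right mult.assoc mult.left_commute)
  also have "\<dots> = s * W n" by (simp add: w_eig W_def sum_distrib_left mult_ac)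
  finally have "?Q + ?R n = 2 * W n - s * W n" .
  with 1 show ?thesis by (simp add: V_def)
qed

lemma energy_sum: "s * (\<Sum>n<N. W n) = (\<Sum>n<N. G n) + V N"
proof -
  have "V 0 = 0" by (simp add: V_def W_def a_0)
  moreover have "s * (\<Sum>n<N. W n) = (\<Sum>n<N. G n) + (\<Sum>n<N. V (Suc n) - V n)"
    by (simp add: sum_distrib_left energy_step sum.distrib)
  ultimately show ?thesis by (simp add: sum_lessThan_telescope)
qed

section \<open>Size of the terms of the energy identity\<close>

lemma ln_a_nonneg: "j \<in> {1..d} \<Longrightarrow> ln (a j n) \<ge> 0"
  using a_ge_1 by simp

lemma W_nonneg: "W n \<ge> 0"
  unfolding W_def using w_pos by (intro sum_nonneg mult_nonneg_nonneg ln_a_nonneg) (auto intro: less_imp_le)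

lemma ln_a_le_W: "j \<in> {1..d} \<Longrightarrow> w j * ln (a j n) \<le> W n"
  unfolding W_def using w_pos
  by (intro member_le_sum) (auto intro!: mult_nonneg_nonneg less_imp_le[of 0 "w _"] ln_a_nonneg)

lemma V_bound: "\<exists>K\<ge>0. \<forall>n L. (\<forall>j\<in>{1..d}. ln (a j n) \<le> L) \<longrightarrow> \<bar>V n\<bar> \<le> K * L"
proof -
  define K1 where "K1 = (\<Sum>j\<in>{1..d}. w j * (\<Sum>i\<in>{i\<in>{1..d}. (i, j) \<in> Ori}. of_int \<bar>C i j\<bar>))"
  define K2 where "K2 = (\<Sum>j\<in>{1..d}. w j)"
  have K: "K1 \<ge> 0" "K2 \<ge> 0"
    unfolding K1_def K2_def using w_pos
    by (auto intro!: sum_nonneg mult_nonneg_nonneg less_imp_le[of 0 "w _"])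
  have "\<bar>V n\<bar> \<le> (K1 + K2) * L" if L: "\<forall>j\<in>{1..d}. ln (a j n) \<le> L" for n L
  proof -
    let ?R = "\<Sum>j\<in>{1..d}. w j * (\<Sum>i\<in>{i\<in>{1..d}. (i, j) \<in> Ori}. of_int \<bar>C i j\<bar> * ln (a i n))"
    have "?R \<le> (\<Sum>j\<in>{1..d}. w j * (\<Sum>i\<in>{i\<in>{1..d}. (i, j) \<in> Ori}. of_int \<bar>C i j\<bar> * L))"
      using L w_pos by (intro sum_mono mult_left_mono) (auto intro: less_imp_le)
    also have "\<dots> = K1 * L" by (simp add: K1_def sum_distrib_right mult.assoc)
    finally have "?R \<le> K1 * L" .
    moreover have "?R \<ge> 0"
      using w_pos by (intro sum_nonneg mult_nonneg_nonneg ln_a_nonneg) (auto intro: less_imp_le)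
    moreover have "W n \<le> K2 * L"
      unfolding W_def K2_def sum_distrib_right using L w_pos
      by (intro sum_mono mult_left_mono) (auto intro: less_imp_le)
    moreover have "\<bar>V n\<bar> \<le> max ?R (W n)" using W_nonneg[of n] \<open>?R \<ge> 0\<close> by (auto simp: V_def)
    ultimately show ?thesis using W_nonneg[of n] by (auto simp: distrib_right)
  qed
  then show ?thesis using K by (intro exI[of _ "K1 + K2"]) auto
qed

lemma G_nonneg: "G n \<ge> 0"
  unfolding G_def
proof (intro sum_nonneg mult_nonneg_nonneg)
  fix j assume "j \<in> {1..d}"
  then show "w j \<ge> 0" using w_pos by (simp add: less_imp_le)
  show "ln (1 + 1 / P j n) \<ge> 0" using P_ge_1[of j n] by simp
qed

lemma G_le: "G n \<le> ln 2 * (\<Sum>j\<in>{1..d}. w j)"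
  unfolding G_def sum_distrib_left
proof (rule sum_mono)
  fix j assume j: "j \<in> {1..d}"
  have "ln (1 + 1 / P j n) \<le> ln 2"
    using P_ge_1[of j n] by (subst ln_le_cancel_iff) (auto intro: add_pos_nonneg)
  then show "w j * ln (1 + 1 / P j n) \<le> ln 2 * w j"
    using w_pos[OF j] by (simp add: mult.commute)
qed

section \<open>Bounded frises and the eigenvalue\<close>

text \<open>The sum of \<open>G\<close> is at least \<open>N * e\<close> while \<open>V N\<close>
  stays bounded, so \<open>s * (\<Sum>n<N. W n)\<close> is positive for some \<open>N\<close>, and
  \<open>W\<close> is nonnegative.\<close>

lemma eigenvalue_pos_of_bounded:
  assumes "d \<ge> 1" and "\<forall>j\<in>{1..d}. \<exists>B. \<forall>n. \<bar>a j n\<bar> \<le> B"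
  shows "s > 0"
proof -
  obtain B where B: "\<And>j n. j \<in> {1..d} \<Longrightarrow> a j n \<le> B j"
    using assms(2) by (metis abs_le_D1)
  define L where "L = (\<Sum>j\<in>{1..d}. ln (B j))"
  have lnB: "ln (a j n) \<le> ln (B j)" if "j \<in> {1..d}" for j n
    using B[OF that, of n] a_pos[OF that, of n] by simp
  have L: "ln (a j n) \<le> L" if "j \<in> {1..d}" for j n
  proof -
    have "ln (B j) \<le> L" unfolding L_def
      by (rule member_le_sum[OF that]) (use lnB[of _ 0] ln_a_nonneg[of _ 0] in \<open>force\<close>)+
    then show ?thesis using lnB[OF that, of n] by linarith
  qed
  obtain K where K: "\<And>n. \<bar>V n\<bar> \<le> K * L" using V_bound L by blast
  \<comment> \<open>\<open>D\<close> bounds \<open>1 + P 1 n\<close>. As all terms of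
    \<open>G\<close> are nonnegative, the vertex 1 alone keeps \<open>G\<close> away from 0.\<close>
  define D where "D = B 1 * B 1"
  have one: "1 \<in> {1..d}" using assms by simp
  have PD: "1 + P 1 n \<le> D" for n
    unfolding D_def a_rel[OF one, symmetric]
    using B[OF one] a_pos[OF one] by (intro mult_mono) (auto intro: less_imp_le less_le_trans)
  have D: "D > 0" using PD[of 0] P_ge_1[of 1 0] by linarith
  define e where "e = w 1 * ln (1 + 1 / D)"
  have e: "e > 0" unfolding e_def using D w_pos[OF one] by (intro mult_pos_pos ln_gt_zero) auto
  have G: "e \<le> G n" for n
  proof -
    have P: "P 1 n > 0" "P 1 n \<le> D" using P_ge_1[of 1 n] PD[of n] by linarith+
    then have "ln (1 + 1 / D) \<le> ln (1 + 1 / P 1 n)"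
      using D by (subst ln_le_cancel_iff) (auto intro: add_pos_nonneg divide_left_mono)
    then have "e \<le> w 1 * ln (1 + 1 / P 1 n)"
      unfolding e_def using w_pos[OF one] by simp
    also have "\<dots> \<le> G n"
      unfolding G_def
    proof (rule member_le_sum[OF one])
      fix j assume "j \<in> {1..d} - {1}"
      then have "w j > 0" using w_pos by simp
      then show "w j * ln (1 + 1 / P j n) \<ge> 0" using P_ge_1[of j n] by simp
    qed simp
    finally show ?thesis .
  qed
  obtain N :: nat where N: "real N * e > K * L"
    using e reals_Archimedean3 by blast
  have "real N * e \<le> (\<Sum>n<N. G n)"
    using sum_mono[of "{..<N}" "\<lambda>_. e" G] G by simp
  then have "s * (\<Sum>n<N. W n) > 0" using energy_sum[of N] K[of N] N by linarith
  moreover have "(\<Sum>n<N. W n) \<ge> 0" by (intro sum_nonneg W_nonneg)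
  ultimately show ?thesis by (simp add: zero_less_mult_iff)
qed

text \<open>The logarithms, and with them \<open>V\<close>, grow at most linearly. Dividing the
  summed identity by \<open>\<bar>s\<bar>\<close> bounds the sums of \<open>W\<close> linearly for
  either sign of \<open>s\<close>, as \<open>bounded_of_log_averages\<close> requires.\<close>

lemma bounded_of_eigenvalue_nonzero:
  assumes "s \<noteq> 0" and rat: "\<forall>j\<in>{1..d}. satisfies_linear_recurrence (\<lambda>n. complex_of_real (a j n))"
    and j: "j \<in> {1..d}"
  shows "\<exists>B. \<forall>n. \<bar>a j n\<bar> \<le> B"
proof -
  have "\<forall>j\<in>{1..d}. \<exists>R\<ge>1. \<forall>n. norm (complex_of_real (a j n)) \<le> R ^ Suc n"
    using rat linear_recurrence_exponential_bound by blast
  then obtain R where R: "\<And>j. j \<in> {1..d} \<Longrightarrow> R j \<ge> 1"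
    "\<And>j n. j \<in> {1..d} \<Longrightarrow> \<bar>a j n\<bar> \<le> R j ^ Suc n"
    by (metis norm_of_real)
  define L where "L = (\<Sum>j\<in>{1..d}. ln (R j))"
  have L: "ln (a j n) \<le> real (Suc n) * L" if "j \<in> {1..d}" for j n
  proof -
    have "ln (a j n) \<le> ln (R j ^ Suc n)"
      using R(2)[OF that, of n] a_pos[OF that, of n] by simp
    also have "\<dots> = real (Suc n) * ln (R j)" using R(1)[OF that] by (simp add: ln_realpow del: power_Suc)
    also have "ln (R j) \<le> L"
      unfolding L_def by (rule member_le_sum[OF that]) (use R(1) in auto)
    finally show ?thesis by (simp add: mult_left_mono)
  qed
  obtain K where K: "K \<ge> 0" "\<And>n. \<bar>V n\<bar> \<le> K * (real (Suc n) * L)" 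
    using V_bound L by (meson ballI)
  define c where "c = ln 2 * (\<Sum>j\<in>{1..d}. w j)"
  have c: "c \<ge> 0" using G_le[of 0] G_nonneg[of 0] by (simp add: c_def)
  have Wsum: "\<bar>s\<bar> * (\<Sum>n<N. W n) \<le> (c + K * L) * (real N + 1)" for N
  proof -
    have "(\<Sum>n<N. G n) \<le> real N * c"
      using sum_mono[of "{..<N}" G "\<lambda>_. c"] G_le by (simp add: c_def)
    moreover have "0 \<le> (\<Sum>n<N. G n)" by (intro sum_nonneg G_nonneg)
    ultimately have "\<bar>s * (\<Sum>n<N. W n)\<bar> \<le> real N * c + K * (real (Suc N) * L)"
      unfolding energy_sum using K(2)[of N] by linarith
    moreover have "0 \<le> (\<Sum>n<N. W n)" by (intro sum_nonneg W_nonneg)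
    ultimately show ?thesis using c by (simp add: abs_mult algebra_simps)
  qed
  have avg: "(\<Sum>n<N. ln (a j n)) \<le> (c + K * L) / (\<bar>s\<bar> * w j) * (real N + 1)" for N
  proof -
    have "w j * (\<Sum>n<N. ln (a j n)) \<le> (\<Sum>n<N. W n)"
      unfolding sum_distrib_left by (intro sum_mono ln_a_le_W j)
    then have "\<bar>s\<bar> * (w j * (\<Sum>n<N. ln (a j n))) \<le> \<bar>s\<bar> * (\<Sum>n<N. W n)"
      by (rule mult_left_mono) simp
    also note Wsum[of N]
    finally show ?thesis using w_pos[OF j] \<open>s \<noteq> 0\<close> by (simp add: field_simps)
  qed
  show ?thesis
    by (rule bounded_of_log_averages[OF _ _ _ avg]) (use rat j a_int a_ge_1 in auto)
qed

end

end

theorem theorem1: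
  fixes d :: nat and C :: "nat \<Rightarrow> nat \<Rightarrow> int" and Ori :: "(nat \<times> nat) set"
    and a :: "nat \<Rightarrow> nat \<Rightarrow> real"
  assumes "cartan_matrix d C"
    and "cartan_connected d C"
    and "acyclic_orientation d C Ori"
    and "is_frise d C Ori a"
    and "\<forall>j\<in>{1..d}. satisfies_linear_recurrence (\<lambda>n. complex_of_real (a j n))"
  shows "((\<forall>j\<in>{1..d}. \<exists>B. \<forall>n. \<bar>a j n\<bar> \<le> B) \<longrightarrow> finite_type d C) \<and>
         (\<not> (\<forall>j\<in>{1..d}. \<exists>B. \<forall>n. \<bar>a j n\<bar> \<le> B) \<longrightarrow> affine_type d C)"
proof (cases "d = 0")
  case True
  \<comment> \<open>Without vertices, boundedness and every clause of \<open>finite_type\<close>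
    hold trivially.\<close>
  then show ?thesis by (simp add: finite_type_def)
next
  case False
  then have d: "d \<ge> 1" by simp
  interpret cartan_frise d C Ori a
    using assms by unfold_locales
  obtain s w where w: "\<And>i. i \<in> {1..d} \<Longrightarrow> w i > 0" "\<And>i. i \<in> {1..d} \<Longrightarrow> cmat_vec d C w i = s * w i"
    using perron_vector[OF d] by blast
  show ?thesis
  proof (intro conjI impI)
    assume "\<forall>j\<in>{1..d}. \<exists>B. \<forall>n. \<bar>a j n\<bar> \<le> B"
    then have "s > 0" using eigenvalue_pos_of_bounded[OF w d] by blast
    then show "finite_type d C" using finite_type_of_perron[of w s] w by blast
  next
    assume "\<not> (\<forall>j\<in>{1..d}. \<exists>B. \<forall>n. \<bar>a j n\<bar> \<le> B)"
    \<comment> \<open>A nonzero eigenvalue would bound every sequence.\<close>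
    then have "s = 0" using bounded_of_eigenvalue_nonzero[OF w _ assms(5)] by blast
    then show "affine_type d C" using affine_type_of_perron[of w] w d by simp
  qed
qed

end
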